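(* Let $\rho>0$, and assume that the vector $w\in\mathbb{R}^k$ and the constant $c$ satisfy $$w_1\ge w_2\ge\dots\ge w_k\ge0,\qquad w\ne0,\qquad c\ge0.$$ Denote $\ell=\|w\|_0$. Then $d_\rho(w,c)$ defined by $$d_\rho(w,c)=\begin{cases}0, & \text{if } \frac{\|w\|_\infty}{\sqrt{\|w\|_2^2+c^2}}\le\rho,\\[4pt] \max(w-t_i1_k,0), & \text{if } \frac{w_\ell}{\sqrt{\ell w_\ell^2+c^2}}<\rho<\frac{\|w\|_\infty}{\sqrt{\|w\|_2^2+c^2}},\\[4pt] w-\rho\sqrt{\frac{c^2}{1-k\rho^2}}\,1_k, & \text{if } 0<\rho\le\frac{w_\ell}{\sqrt{\ell w_\ell^2+c^2}},\end{cases}$$ is optimal to the problem $$\min_{s\in\mathbb{R}^k,\ s\ge0}\ \sqrt{\|s-w\|_2^2+c^2}+\rho\langle s,1_k\rangle,$$ where the index $i\in\{1,2,\dots,\ell-1\}$ in the second case is the unique integer satisfying $$w_{i+1}\le t_i:=\sqrt{\frac{w_{i+1}^2+\dots+w_k^2+c^2}{\frac1{\rho^2}-i}}<w_i.$$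
   Context: $k$ is a positive integer; $\|w\|_0$ is the number of nonzero entries of $w$; $\|\cdot\|_2$ and $\|\cdot\|_\infty$ are the $\ell_2$ and $\ell_\infty$ vector norms; $\langle\cdot,\cdot\rangle$ is the standard inner product; $1_k\in\mathbb{R}^k$ is the vector of all ones; the maximum with $0$ and the inequality $s\ge0$ are entrywise.
   Formalization: In the third case, when ℓ<k, the formula is replaced by max(w-ρ√(c²/(1-ℓρ²))1_k,0), since the printed one is infeasible, e.g. for w=(1,0), c=1, ρ=1/2; 0/0 (c=0, ℓρ²=1) is read as 0, and where the first and third cases overlap the first is used. *)

theory Defs
  imports "HOL-Analysis.Analysis"
begin

text \<open>
  Throughout, k is \<open>CARD('k)\<close>, and \<open>e :: nat \<Rightarrow> 'k\<close> is an enumeration of the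
  coordinates (a bijection from \<open>{1..k}\<close> onto the index type), so that the entry
  usually written \<open>w\<^sub>i\<close> is \<open>w $ e i\<close>.
\<close>

definition l0norm :: "real ^ 'k \<Rightarrow> nat" where
  "l0norm w = card {j. w $ j \<noteq> 0}"

definition objective :: "real \<Rightarrow> real ^ 'k \<Rightarrow> real \<Rightarrow> real ^ 'k \<Rightarrow> real" where
  "objective \<rho> w c s = sqrt ((norm (s - w))\<^sup>2 + c\<^sup>2) + \<rho> * (s \<bullet> 1)"

definition pos_part :: "real ^ 'k \<Rightarrow> real ^ 'k" where
  "pos_part v = (\<chi> j. max (v $ j) 0)"

definition upper_ratio :: "real ^ 'k \<Rightarrow> real \<Rightarrow> real" where
  "upper_ratio w c = infnorm w / sqrt ((norm w)\<^sup>2 + c\<^sup>2)"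

definition lower_ratio :: "(nat \<Rightarrow> 'k) \<Rightarrow> real ^ 'k \<Rightarrow> real \<Rightarrow> real" where
  "lower_ratio e w c =
     (let l = l0norm w in w $ e l / sqrt (real l * (w $ e l)\<^sup>2 + c\<^sup>2))"

text \<open>
  If \<open>1 / \<rho>\<^sup>2 \<le> i\<close>, the value below is a nonpositive number that has no meaning; it
  is never selected by \<open>is_threshold_index\<close>, which forces it to be at least
  \<open>w\<^sub>i\<^sub>+\<^sub>1 > 0\<close>.
\<close>

definition threshold :: "(nat \<Rightarrow> 'k) \<Rightarrow> real \<Rightarrow> real ^ 'k \<Rightarrow> real \<Rightarrow> nat \<Rightarrow> real" where
  "threshold e \<rho> w c i =
     sqrt (((\<Sum>j = i + 1..CARD('k). (w $ e j)\<^sup>2) + c\<^sup>2) / (1 / \<rho>\<^sup>2 - real i))"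

definition is_threshold_index ::
    "(nat \<Rightarrow> 'k) \<Rightarrow> real \<Rightarrow> real ^ 'k \<Rightarrow> real \<Rightarrow> nat \<Rightarrow> bool" where
  "is_threshold_index e \<rho> w c i \<longleftrightarrow>
     1 \<le> i \<and> i < l0norm w \<and>
     w $ e (i + 1) \<le> threshold e \<rho> w c i \<and> threshold e \<rho> w c i < w $ e i"

text \<open>
  Third case, \<open>0 < \<rho> \<le> lower_ratio e w c\<close>. The formula
  \<open>w - \<rho> sqrt (c\<^sup>2 / (1 - k \<rho>\<^sup>2)) 1\<close> is correct when all entries of w are
  nonzero, but in general not otherwise: for \<open>w = (1, 0)\<close>, \<open>c = 1\<close>, \<open>\<rho> = 1/2\<close> it
  yields a vector with a negative entry. If w has vanishing entries, the shift must be
  computed from the number of nonzero entries and the result truncated at 0.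
  For \<open>c = 0\<close> the shift is 0 in both formulas (including \<open>0 / 0 = 0\<close>).
\<close>

definition small_case :: "real \<Rightarrow> real ^ 'k \<Rightarrow> real \<Rightarrow> real ^ 'k" where
  "small_case \<rho> w c =
     (if l0norm w = CARD('k)
      then w - (\<rho> * sqrt (c\<^sup>2 / (1 - real CARD('k) * \<rho>\<^sup>2))) *\<^sub>R 1
      else pos_part (w - (\<rho> * sqrt (c\<^sup>2 / (1 - real (l0norm w) * \<rho>\<^sup>2))) *\<^sub>R 1))"

text \<open>
  The final branch is reached exactly if \<open>\<rho> \<le> lower_ratio e w c\<close> and the first condition
  fails.
\<close>

definition d_opt :: "(nat \<Rightarrow> 'k) \<Rightarrow> real \<Rightarrow> real ^ 'k \<Rightarrow> real \<Rightarrow> real ^ 'k" where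
  "d_opt e \<rho> w c =
     (if upper_ratio w c \<le> \<rho> then 0
      else if lower_ratio e w c < \<rho> \<and> \<rho> < upper_ratio w c
      then pos_part (w - threshold e \<rho> w c (THE i. is_threshold_index e \<rho> w c i) *\<^sub>R 1)
      else small_case \<rho> w c)"

end

theory Submission
  imports Defs
begin

text \<open>
  The objective is \<open>s \<mapsto> \<parallel>(w - s, c)\<parallel> + \<rho> \<langle>s, 1\<rangle>\<close> with the Euclidean norm on
  \<open>\<real>\<^sup>k \<times> \<real>\<close>. That norm is the maximum of \<open>\<langle>w - s, u\<rangle> + c v\<close> over the unit ball of
  pairs \<open>(u, v)\<close>, so a pair with \<open>u \<le> \<rho> 1\<close> that attains the norm at s and satisfies
  \<open>u\<^sub>j = \<rho>\<close> wherever \<open>s\<^sub>j \<noteq> 0\<close> certifies that s is optimal (\<open>optimal_if_certificate\<close>).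

  Try the candidates \<open>s = max (w - t 1) 0\<close> with a level \<open>t > 0\<close>. Their residual
  \<open>w - s = min w t\<close> reaches its upper bound t wherever \<open>s\<^sub>j \<noteq> 0\<close>. Dividing the residual and
  c by \<open>N = \<parallel>(min w t, c)\<parallel>\<close> therefore gives a certificate as soon as \<open>t = \<rho> N\<close>
  (\<open>optimal_if_level_fixed_point\<close>). The branches of the formula are the solutions of
  this scalar fixed point equation, according to the entries that exceed the level: none
  (so \<open>s = 0\<close>), the first i, or, up to ties, all nonzero ones. The one exception is
  \<open>c = 0\<close> in the third branch, where the level is 0 and N vanishes; there \<open>u = \<rho>\<close> on the
  support of w and 0 elsewhere is a certificate.

  It remains to find i in the second branch. Squaring turns the two defining inequalities into
  \<open>gap i > 0\<close> and \<open>gap (i + 1) \<le> 0\<close> for one and the same function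
  \<open>gap\<close>. The two bounds on \<open>\<rho>\<close> say that it is positive at 1 and negative at the
  last nonzero entry, and it never becomes positive again after it was nonpositive
  (\<open>gap_nonpos_Suc\<close>), so it has exactly one sign change.
\<close>

section \<open>Optimality certificates\<close>

lemma inner_add_mult_le_sqrt:
  fixes y u :: "'a::real_inner" and c v :: real
  assumes "(norm u)\<^sup>2 + v\<^sup>2 \<le> 1"
  shows "y \<bullet> u + c * v \<le> sqrt ((norm y)\<^sup>2 + c\<^sup>2)"
proof -
  have "y \<bullet> u + c * v = (y, c) \<bullet> (u, v)"
    by simp
  also have "\<dots> \<le> norm (y, c) * norm (u, v)"
    by (rule norm_cauchy_schwarz)
  also have "\<dots> \<le> norm (y, c) * 1"
    using assms by (intro mult_left_mono) (auto simp: norm_Pair)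
  finally show ?thesis
    by (simp add: norm_Pair)
qed

text \<open>
  Passing from s to a feasible x changes the lower bound
  \<open>\<langle>w - x, u\<rangle> + c v + \<rho> \<langle>x, 1\<rangle>\<close> of the objective by
  \<open>\<langle>x - s, \<rho> 1 - u\<rangle>\<close>. This is nonnegative by complementary slackness, and the bound is
  attained at s.
\<close>

lemma optimal_if_certificate:
  fixes w s u :: "real ^ 'k::finite"
  assumes s: "0 \<le> s"
    and ball: "(norm u)\<^sup>2 + v\<^sup>2 \<le> 1"
    and le: "\<And>j. u $ j \<le> \<rho>"
    and slack: "\<And>j. s $ j \<noteq> 0 \<Longrightarrow> u $ j = \<rho>"
    and attained: "(w - s) \<bullet> u + c * v = sqrt ((norm (s - w))\<^sup>2 + c\<^sup>2)"
  shows "is_arg_min (objective \<rho> w c) (\<lambda>s. 0 \<le> s) s"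
proof -
  have "objective \<rho> w c s \<le> objective \<rho> w c x" if x: "0 \<le> x" for x
  proof -
    have "0 \<le> (\<Sum>j\<in>UNIV. (x $ j - s $ j) * (\<rho> - u $ j))"
    proof (rule sum_nonneg)
      fix j
      show "0 \<le> (x $ j - s $ j) * (\<rho> - u $ j)"
        using le[of j] slack[of j] x by (cases "s $ j = 0") (auto simp: less_eq_vec_def)
    qed
    also have "\<dots> = (x - s) \<bullet> (\<rho> *\<^sub>R 1 - u)"
      by (simp add: inner_vec_def)
    finally have "(w - s) \<bullet> u + c * v + \<rho> * (s \<bullet> 1)
        \<le> (w - x) \<bullet> u + c * v + \<rho> * (x \<bullet> 1)"
      by (simp add: inner_diff_left inner_diff_right algebra_simps)
    also have "(w - x) \<bullet> u + c * v \<le> sqrt ((norm (x - w))\<^sup>2 + c\<^sup>2)"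
      using inner_add_mult_le_sqrt[OF ball, of "w - x" c] by (simp add: norm_minus_commute)
    finally show ?thesis
      by (simp add: objective_def attained)
  qed
  with s show ?thesis
    by (auto simp: is_arg_min_linorder)
qed

lemma power2_norm_vec:
  fixes x :: "real ^ 'k::finite"
  shows "(norm x)\<^sup>2 = (\<Sum>j\<in>UNIV. (x $ j)\<^sup>2)"
  unfolding power2_norm_eq_inner by (simp add: inner_vec_def power2_eq_square)

text \<open>
  With \<open>r = min w t\<close> for the residual and \<open>N = t / \<rho>\<close>, the certificate is
  \<open>(r, c) / N\<close>: the gradient of the norm at \<open>(r, c)\<close>.
\<close>

lemma optimal_if_level_fixed_point:
  fixes w :: "real ^ 'k::finite"
  assumes rho: "\<rho> > 0" and t: "t > 0"
    and level: "(\<Sum>j\<in>UNIV. (min (w $ j) t)\<^sup>2) + c\<^sup>2 = (t / \<rho>)\<^sup>2"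
  shows "is_arg_min (objective \<rho> w c) (\<lambda>s. 0 \<le> s) (pos_part (w - t *\<^sub>R 1))"
proof -
  define N where "N = t / \<rho>"
  define r where "r = (\<chi> j. min (w $ j) t)"
  define s where "s = pos_part (w - t *\<^sub>R 1)"
  have N: "N > 0"
    using rho t by (simp add: N_def)
  have r: "w - s = r"
    by (auto simp: vec_eq_iff r_def s_def pos_part_def)
  have nr: "(norm r)\<^sup>2 + c\<^sup>2 = N\<^sup>2"
    using level by (simp add: power2_norm_vec r_def N_def)
  have norm_res: "norm (s - w) = norm r"
    using r by (metis norm_minus_commute)
  have "is_arg_min (objective \<rho> w c) (\<lambda>s. 0 \<le> s) s"
  proof (rule optimal_if_certificate[where u = "(1 / N) *\<^sub>R r" and v = "c / N"])
    show "0 \<le> s"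
      by (simp add: s_def pos_part_def less_eq_vec_def)
    have "(norm ((1 / N) *\<^sub>R r))\<^sup>2 + (c / N)\<^sup>2 = ((norm r)\<^sup>2 + c\<^sup>2) / N\<^sup>2"
      using N by (simp add: power_divide add_divide_distrib)
    then show "(norm ((1 / N) *\<^sub>R r))\<^sup>2 + (c / N)\<^sup>2 \<le> 1"
      using N nr by simp
    show "((1 / N) *\<^sub>R r) $ j \<le> \<rho>" for j
    proof -
      have "r $ j \<le> \<rho> * N"
        using rho by (simp add: r_def N_def)
      then show ?thesis
        using N by (simp add: field_simps)
    qed
    show "((1 / N) *\<^sub>R r) $ j = \<rho>" if "s $ j \<noteq> 0" for j
    proof -
      have "t < w $ j"
        using that by (simp add: s_def pos_part_def max_def split: if_splits)
      then show ?thesis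
        using rho t by (simp add: r_def N_def)
    qed
    have "(w - s) \<bullet> ((1 / N) *\<^sub>R r) + c * (c / N) = ((norm r)\<^sup>2 + c\<^sup>2) / N"
      unfolding r power2_norm_eq_inner by (simp add: power2_eq_square add_divide_distrib)
    also have "\<dots> = sqrt ((norm (s - w))\<^sup>2 + c\<^sup>2)"
      using N unfolding norm_res nr by (simp add: power2_eq_square)
    finally show "(w - s) \<bullet> ((1 / N) *\<^sub>R r) + c * (c / N) = sqrt ((norm (s - w))\<^sup>2 + c\<^sup>2)" .
  qed
  then show ?thesis
    by (simp add: s_def)
qed

section \<open>Sorted vectors\<close>

locale sorted_vector =
  fixes e :: "nat \<Rightarrow> 'k::finite" and w :: "real ^ 'k"
  assumes enum: "bij_betw e {1..CARD('k)} UNIV"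
    and sorted: "\<And>i. 1 \<le> i \<Longrightarrow> i < CARD('k) \<Longrightarrow> w $ e (i + 1) \<le> w $ e i"
    and last_nonneg: "w $ e CARD('k) \<ge> 0"
    and nonzero: "w \<noteq> 0"
begin

lemma entries_antimono:
  assumes "1 \<le> i" "i \<le> j" "j \<le> CARD('k)"
  shows "w $ e j \<le> w $ e i"
  using assms(2,3)
proof (induction j rule: dec_induct)
  case (step n)
  then show ?case
    using sorted[of n] assms(1) by simp
qed simp

lemma enumerated: obtains i where "1 \<le> i" "i \<le> CARD('k)" "j = e i"
  using enum unfolding bij_betw_def by (metis UNIV_I atLeastAtMost_iff imageE)

lemma nonneg: "w $ j \<ge> 0"
proof -
  obtain i where "1 \<le> i" "i \<le> CARD('k)" "j = e i"
    by (rule enumerated)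
  then show ?thesis
    using entries_antimono[of i "CARD('k)"] last_nonneg by simp
qed

lemma sum_enum: "(\<Sum>j\<in>UNIV. f j) = (\<Sum>i = 1..CARD('k). f (e i))"
  using sum.reindex_bij_betw[OF enum, of f] by simp

text \<open>Since the entries decrease to something nonnegative, the support is an initial segment.\<close>

lemma support: "i \<in> {1..CARD('k)} \<Longrightarrow> w $ e i \<noteq> 0 \<longleftrightarrow> i \<le> l0norm w"
  and l0norm_bounds: "1 \<le> l0norm w" "l0norm w \<le> CARD('k)"
proof -
  define S where "S = {i \<in> {1..CARD('k)}. w $ e i \<noteq> 0}"
  have image: "{j. w $ j \<noteq> 0} = e ` S"
    unfolding S_def using enumerated by (auto simp: image_iff) (metis enumerated)
  have inj: "inj_on e S"
    using bij_betw_imp_inj_on[OF enum] by (rule inj_on_subset) (auto simp: S_def)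
  have card: "l0norm w = card S"
    unfolding l0norm_def image by (rule card_image[OF inj])
  have fin: "finite S"
    by (simp add: S_def)
  have ne: "S \<noteq> {}"
    using nonzero image by (auto simp: vec_eq_iff)
  have down: "i \<in> S" if "1 \<le> i" "i \<le> j" "j \<in> S" for i j
    using that entries_antimono[of i j] nonneg[of "e j"] by (auto simp: S_def)
  have "S = {1..Max S}"
  proof
    have "1 \<le> i" if "i \<in> S" for i
      using that by (simp add: S_def)
    then show "S \<subseteq> {1..Max S}"
      using Max_ge[OF fin] by auto
    show "{1..Max S} \<subseteq> S"
      using down[of _ "Max S"] Max_in[OF fin ne] by auto
  qed
  then have S: "S = {1..l0norm w}"
    by (metis card card_atLeastAtMost diff_Suc_1)
  have mem: "i \<in> S \<longleftrightarrow> i \<in> {1..CARD('k)} \<and> w $ e i \<noteq> 0" for i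
    by (simp add: S_def)
  show "1 \<le> l0norm w"
    using S ne by auto
  then have "l0norm w \<in> S"
    using S by simp
  then show "l0norm w \<le> CARD('k)"
    using mem by simp
  show "w $ e i \<noteq> 0 \<longleftrightarrow> i \<le> l0norm w" if "i \<in> {1..CARD('k)}"
  proof -
    have "w $ e i \<noteq> 0 \<longleftrightarrow> i \<in> S"
      using that by (simp add: mem)
    also have "\<dots> \<longleftrightarrow> i \<le> l0norm w"
      using that unfolding S by simp
    finally show ?thesis .
  qed
qed

lemma pos_up_to_l0norm:
  assumes "1 \<le> i" "i \<le> l0norm w"
  shows "w $ e i > 0"
  using support[of i] assms l0norm_bounds nonneg[of "e i"] by auto

lemma zero_beyond_l0norm:
  assumes "l0norm w < i" "i \<le> CARD('k)"
  shows "w $ e i = 0"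
  using support[of i] assms by auto

lemma infnorm_eq: "infnorm w = w $ e 1"
  unfolding infnorm_cart
proof (rule cSup_eq_maximum)
  have "w $ e 1 = \<bar>w $ e 1\<bar>"
    using nonneg[of "e 1"] by simp
  then show "w $ e 1 \<in> {\<bar>w $ i\<bar> |i. i \<in> UNIV}"
    by blast
  show "x \<le> w $ e 1" if mem: "x \<in> {\<bar>w $ i\<bar> |i. i \<in> UNIV}" for x
  proof -
    obtain j where x: "x = \<bar>w $ j\<bar>"
      using mem by blast
    obtain i where "1 \<le> i" "i \<le> CARD('k)" "j = e i"
      by (rule enumerated)
    then show ?thesis
      using entries_antimono[of 1 i] nonneg[of j] by (simp add: x)
  qed
qed

section \<open>The threshold index\<close>

definition tail :: "real \<Rightarrow> nat \<Rightarrow> real" where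
  "tail c i = (\<Sum>j = i + 1..CARD('k). (w $ e j)\<^sup>2) + c\<^sup>2"

text \<open>
  For \<open>i < 1 / \<rho>\<^sup>2\<close>, the inequality \<open>t\<^sub>i < w\<^sub>i\<close>, squared and cleared of
  denominators, is \<open>gap i > 0\<close>.
\<close>

definition gap :: "real \<Rightarrow> real \<Rightarrow> nat \<Rightarrow> real" where
  "gap \<rho> c i = (w $ e i)\<^sup>2 * (1 / \<rho>\<^sup>2 - real i) - tail c i"

lemma tail_nonneg: "tail c i \<ge> 0"
  unfolding tail_def by (intro add_nonneg_nonneg sum_nonneg) auto

lemma tail_rec: "i < CARD('k) \<Longrightarrow> tail c i = (w $ e (i + 1))\<^sup>2 + tail c (i + 1)"
  by (simp add: tail_def sum.atLeast_Suc_atMost)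

lemma tail_l0norm: "tail c (l0norm w) = c\<^sup>2"
  using zero_beyond_l0norm by (simp add: tail_def)

lemma tail_0: "tail c 0 = (norm w)\<^sup>2 + c\<^sup>2"
  by (simp add: tail_def power2_norm_vec sum_enum)

text \<open>
  Moving \<open>w\<^sub>i\<^sub>+\<^sub>1\<close> out of the tail lets the index shift cancel. This is why
  the inequality \<open>w\<^sub>i\<^sub>+\<^sub>1 \<le> t\<^sub>i\<close> is a condition on \<open>gap (i + 1)\<close>.
\<close>

lemma gap_Suc:
  assumes "i < CARD('k)"
  shows "gap \<rho> c (i + 1) = (w $ e (i + 1))\<^sup>2 * (1 / \<rho>\<^sup>2 - real i) - tail c i"
  unfolding gap_def tail_rec[OF assms] by (simp add: algebra_simps)

text \<open>
  While \<open>i < 1 / \<rho>\<^sup>2\<close> the gap decreases together with the entries; beyond that point both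
  of its terms are nonpositive.
\<close>

lemma gap_nonpos_Suc:
  assumes i: "1 \<le> i" "i < CARD('k)" and gap: "gap \<rho> c i \<le> 0"
  shows "gap \<rho> c (i + 1) \<le> 0"
proof (cases "1 / \<rho>\<^sup>2 - real i \<le> 0")
  case True
  then have "(w $ e (i + 1))\<^sup>2 * (1 / \<rho>\<^sup>2 - real i) \<le> 0"
    by (simp add: mult_nonneg_nonpos)
  then show ?thesis
    using tail_nonneg[of c i] unfolding gap_Suc[OF i(2)] by linarith
next
  case False
  have "(w $ e (i + 1))\<^sup>2 \<le> (w $ e i)\<^sup>2"
    using sorted[OF i] nonneg by (simp add: power_mono)
  then have "(w $ e (i + 1))\<^sup>2 * (1 / \<rho>\<^sup>2 - real i) \<le> (w $ e i)\<^sup>2 * (1 / \<rho>\<^sup>2 - real i)"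
    using False by (intro mult_right_mono) auto
  then show ?thesis
    using gap unfolding gap_Suc[OF i(2)] by (simp add: gap_def)
qed

lemma gap_nonpos_mono:
  assumes "1 \<le> i" "i \<le> j" "j \<le> CARD('k)" "gap \<rho> c i \<le> 0"
  shows "gap \<rho> c j \<le> 0"
  using assms(2,3)
proof (induction j rule: dec_induct)
  case base
  show ?case by (rule assms(4))
next
  case (step n)
  then show ?case
    using gap_nonpos_Suc[of n] assms(1) by simp
qed

lemma threshold_eq: "threshold e \<rho> w c i = sqrt (tail c i / (1 / \<rho>\<^sup>2 - real i))"
  by (simp add: threshold_def tail_def)

text \<open>
  Otherwise the threshold would be nonpositive, including the value \<open>x / 0 = 0\<close>, and hence
  below \<open>w\<^sub>i\<^sub>+\<^sub>1\<close>, which is positive.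
\<close>

lemma threshold_index_imp_less:
  assumes "is_threshold_index e \<rho> w c i"
  shows "real i < 1 / \<rho>\<^sup>2"
proof (rule ccontr)
  assume "\<not> real i < 1 / \<rho>\<^sup>2"
  then have "threshold e \<rho> w c i \<le> 0"
    using tail_nonneg[of c i] by (simp add: threshold_eq divide_nonneg_nonpos)
  then show False
    using assms pos_up_to_l0norm[of "i + 1"] by (auto simp: is_threshold_index_def)
qed

text \<open>
  A positive gap also forces \<open>i < 1 / \<rho>\<^sup>2\<close>, so squaring and clearing the denominator
  loses nothing.
\<close>

lemma threshold_index_iff_gap:
  "is_threshold_index e \<rho> w c i \<longleftrightarrow>
     1 \<le> i \<and> i < l0norm w \<and> 0 < gap \<rho> c i \<and> gap \<rho> c (i + 1) \<le> 0"
proof (cases "1 \<le> i \<and> i < l0norm w \<and> real i < 1 / \<rho>\<^sup>2")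
  case True
  define D where "D = 1 / \<rho>\<^sup>2 - real i"
  have D: "D > 0"
    using True by (simp add: D_def)
  have i: "i < CARD('k)"
    using True l0norm_bounds by simp
  have "threshold e \<rho> w c i < w $ e i \<longleftrightarrow> tail c i / D < (w $ e i)\<^sup>2"
    using nonneg[of "e i"] real_sqrt_less_iff[of "tail c i / D" "(w $ e i)\<^sup>2"]
    by (simp add: threshold_eq D_def[symmetric])
  also have "\<dots> \<longleftrightarrow> 0 < gap \<rho> c i"
    using D by (simp add: gap_def D_def[symmetric] field_simps)
  finally have 1: "threshold e \<rho> w c i < w $ e i \<longleftrightarrow> 0 < gap \<rho> c i" .
  have "w $ e (i + 1) \<le> threshold e \<rho> w c i \<longleftrightarrow> (w $ e (i + 1))\<^sup>2 \<le> tail c i / D"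
    using nonneg[of "e (i + 1)"] real_sqrt_le_iff[of "(w $ e (i + 1))\<^sup>2" "tail c i / D"]
    by (simp add: threshold_eq D_def[symmetric])
  also have "\<dots> \<longleftrightarrow> gap \<rho> c (i + 1) \<le> 0"
    using D unfolding gap_Suc[OF i] by (simp add: D_def[symmetric] field_simps)
  finally show ?thesis
    using 1 by (auto simp: is_threshold_index_def)
next
  case False
  have "real i < 1 / \<rho>\<^sup>2" if "0 < gap \<rho> c i"
  proof (rule ccontr)
    assume "\<not> real i < 1 / \<rho>\<^sup>2"
    then have "(w $ e i)\<^sup>2 * (1 / \<rho>\<^sup>2 - real i) \<le> 0"
      by (simp add: mult_nonneg_nonpos)
    then show False
      using that tail_nonneg[of c i] by (simp add: gap_def)
  qed
  then show ?thesis
    using False threshold_index_imp_less[of \<rho> c i] by (auto simp: is_threshold_index_def)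
qed

lemma less_upper_ratio_iff:
  assumes "\<rho> > 0"
  shows "\<rho> < upper_ratio w c \<longleftrightarrow> 0 < gap \<rho> c 1"
proof -
  have pos: "(norm w)\<^sup>2 + c\<^sup>2 > 0"
    using nonzero by (simp add: add_pos_nonneg)
  have "\<rho> < upper_ratio w c \<longleftrightarrow> \<rho> * sqrt ((norm w)\<^sup>2 + c\<^sup>2) < w $ e 1"
    using pos by (simp add: upper_ratio_def infnorm_eq pos_less_divide_eq)
  also have "\<dots> \<longleftrightarrow> (\<rho> * sqrt ((norm w)\<^sup>2 + c\<^sup>2))\<^sup>2 < (w $ e 1)\<^sup>2"
    using assms nonneg[of "e 1"] pos by (simp add: power_mono_iff flip: not_le)
  also have "\<dots> \<longleftrightarrow> (norm w)\<^sup>2 + c\<^sup>2 < (w $ e 1)\<^sup>2 / \<rho>\<^sup>2"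
    using assms pos by (simp add: power_mult_distrib pos_less_divide_eq mult.commute)
  also have "\<dots> \<longleftrightarrow> 0 < gap \<rho> c 1"
    using gap_Suc[of 0 \<rho> c] by (simp add: tail_0)
  finally show ?thesis .
qed

lemma lower_ratio_less_iff:
  assumes "\<rho> > 0"
  shows "lower_ratio e w c < \<rho> \<longleftrightarrow> gap \<rho> c (l0norm w) < 0"
proof -
  define l where "l = l0norm w"
  have wl: "w $ e l > 0" and l: "l \<ge> 1"
    using l0norm_bounds pos_up_to_l0norm by (auto simp: l_def)
  have pos: "real l * (w $ e l)\<^sup>2 + c\<^sup>2 > 0"
    using wl l by (simp add: add_pos_nonneg)
  have "lower_ratio e w c < \<rho> \<longleftrightarrow> w $ e l < \<rho> * sqrt (real l * (w $ e l)\<^sup>2 + c\<^sup>2)"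
    using pos by (simp add: lower_ratio_def Let_def l_def[symmetric] pos_divide_less_eq)
  also have "\<dots> \<longleftrightarrow> (w $ e l)\<^sup>2 < (\<rho> * sqrt (real l * (w $ e l)\<^sup>2 + c\<^sup>2))\<^sup>2"
    using assms wl pos by (simp add: power_mono_iff flip: not_le)
  also have "\<dots> \<longleftrightarrow> (w $ e l)\<^sup>2 / \<rho>\<^sup>2 < real l * (w $ e l)\<^sup>2 + c\<^sup>2"
    using assms pos by (simp add: power_mult_distrib pos_divide_less_eq mult.commute)
  also have "\<dots> \<longleftrightarrow> gap \<rho> c l < 0"
    by (simp add: gap_def l_def tail_l0norm algebra_simps)
  finally show ?thesis
    by (simp add: l_def)
qed

text \<open>The index is the predecessor of the first place where the gap is nonpositive.\<close>

lemma ex1_threshold_index: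
  assumes "\<rho> > 0" "lower_ratio e w c < \<rho>" "\<rho> < upper_ratio w c"
  shows "\<exists>!i. is_threshold_index e \<rho> w c i"
proof (rule ex_ex1I)
  define P where "P i \<longleftrightarrow> 1 \<le> i \<and> gap \<rho> c i \<le> 0" for i
  define m where "m = (LEAST i. P i)"
  have first: "0 < gap \<rho> c 1"
    using assms by (simp add: less_upper_ratio_iff)
  have last: "P (l0norm w)"
    using assms l0norm_bounds by (simp add: P_def lower_ratio_less_iff less_imp_le)
  have m: "P m" "m \<le> l0norm w"
    unfolding m_def using last by (auto intro: LeastI Least_le)
  have "m \<noteq> 1"
    using m(1) first by (auto simp: P_def)
  then obtain i where i: "m = i + 1" "1 \<le> i"
    using m(1) by (cases m) (auto simp: P_def)
  have "\<not> P i"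
    using i not_less_Least[of i P] by (simp add: m_def[symmetric])
  then have "is_threshold_index e \<rho> w c i"
    using m i by (auto simp: threshold_index_iff_gap P_def)
  then show "\<exists>i. is_threshold_index e \<rho> w c i" ..
next
  have False if "is_threshold_index e \<rho> w c i" "is_threshold_index e \<rho> w c j" "i < j" for i j
    using that gap_nonpos_mono[of "i + 1" j \<rho> c] l0norm_bounds
    by (auto simp: threshold_index_iff_gap)
  then show "i = j" if "is_threshold_index e \<rho> w c i" "is_threshold_index e \<rho> w c j" for i j
    using that by (metis linorder_neqE_nat)
qed

section \<open>Optimality in each regime\<close>

text \<open>
  While the level stays between two consecutive entries, the left-hand side of the fixed point
  equation is a quadratic polynomial in it, so the equation can be solved explicitly.
\<close>

lemma sum_min_level:
  assumes i: "i \<le> CARD('k)"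
    and above: "\<And>j. 1 \<le> j \<Longrightarrow> j \<le> i \<Longrightarrow> t \<le> w $ e j"
    and below: "\<And>j. i < j \<Longrightarrow> j \<le> CARD('k) \<Longrightarrow> w $ e j \<le> t"
  shows "(\<Sum>j\<in>UNIV. (min (w $ j) t)\<^sup>2) + c\<^sup>2 = real i * t\<^sup>2 + tail c i"
proof -
  have "(\<Sum>j\<in>UNIV. (min (w $ j) t)\<^sup>2) = (\<Sum>j = 1..CARD('k). (min (w $ e j) t)\<^sup>2)"
    by (rule sum_enum)
  also have "\<dots> = (\<Sum>j = 1..i. (min (w $ e j) t)\<^sup>2) + (\<Sum>j = i + 1..CARD('k). (min (w $ e j) t)\<^sup>2)"
    using sum.ub_add_nat[of 1 i "\<lambda>j. (min (w $ e j) t)\<^sup>2" "CARD('k) - i"] i by simp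
  also have "(\<Sum>j = 1..i. (min (w $ e j) t)\<^sup>2) = (\<Sum>j = 1..i. t\<^sup>2)"
    using above by (intro sum.cong) (auto simp: min_absorb2)
  also have "(\<Sum>j = i + 1..CARD('k). (min (w $ e j) t)\<^sup>2) = (\<Sum>j = i + 1..CARD('k). (w $ e j)\<^sup>2)"
    using below by (intro sum.cong) (auto simp: min_absorb1)
  finally show ?thesis
    by (simp add: tail_def)
qed

text \<open>
  A level that is at least every entry leaves w as the residual, so the fixed point equation
  reads \<open>t = \<rho> \<parallel>(w, c)\<parallel>\<close>. The hypothesis says that this t is indeed at least the
  largest entry.
\<close>

lemma zero_optimal:
  assumes rho: "\<rho> > 0" and "upper_ratio w c \<le> \<rho>"
  shows "is_arg_min (objective \<rho> w c) (\<lambda>s. 0 \<le> s) 0"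
proof -
  define N where "N = sqrt ((norm w)\<^sup>2 + c\<^sup>2)"
  define t where "t = \<rho> * N"
  have N: "N > 0"
    using nonzero by (simp add: N_def add_pos_nonneg)
  have below: "w $ e j \<le> t" if "0 < j" "j \<le> CARD('k)" for j
  proof -
    have "w $ e 1 \<le> t"
      using assms N by (simp add: upper_ratio_def infnorm_eq N_def[symmetric] t_def pos_divide_le_eq)
    then show ?thesis
      using entries_antimono[of 1 j] that by simp
  qed
  have "(\<Sum>j\<in>UNIV. (min (w $ j) t)\<^sup>2) + c\<^sup>2 = (t / \<rho>)\<^sup>2"
    using sum_min_level[of 0 t c] below rho by (simp add: tail_0 t_def N_def)
  then have "is_arg_min (objective \<rho> w c) (\<lambda>s. 0 \<le> s) (pos_part (w - t *\<^sub>R 1))"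
    using rho N by (intro optimal_if_level_fixed_point) (auto simp: t_def)
  moreover have "pos_part (w - t *\<^sub>R 1) = 0"
  proof -
    have "w $ j \<le> t" for j
      using below enumerated[of j] by (metis less_eq_Suc_le One_nat_def)
    then show ?thesis
      by (simp add: vec_eq_iff pos_part_def max_absorb2)
  qed
  ultimately show ?thesis
    by simp
qed

text \<open>
  \<open>t\<^sub>i\<close> is the root of \<open>i t\<^sup>2 + tail c i = t\<^sup>2 / \<rho>\<^sup>2\<close>, and the defining
  inequalities of the index put it into the interval where this is the fixed point equation.
\<close>

lemma shrunk_by_threshold_optimal:
  assumes rho: "\<rho> > 0" and index: "is_threshold_index e \<rho> w c i"
  shows "is_arg_min (objective \<rho> w c) (\<lambda>s. 0 \<le> s) (pos_part (w - threshold e \<rho> w c i *\<^sub>R 1))"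
proof (rule optimal_if_level_fixed_point[OF rho])
  define t where "t = threshold e \<rho> w c i"
  have i: "1 \<le> i" "i < l0norm w" "w $ e (i + 1) \<le> t" "t < w $ e i"
    using index by (auto simp: is_threshold_index_def t_def)
  show "threshold e \<rho> w c i > 0"
    using i pos_up_to_l0norm[of "i + 1"] by (simp add: t_def)
  have "t\<^sup>2 = tail c i / (1 / \<rho>\<^sup>2 - real i)"
    using threshold_index_imp_less[OF index] tail_nonneg[of c i] by (simp add: t_def threshold_eq)
  then have tail: "tail c i = t\<^sup>2 * (1 / \<rho>\<^sup>2 - real i)"
    using threshold_index_imp_less[OF index] by simp
  have "(\<Sum>j\<in>UNIV. (min (w $ j) t)\<^sup>2) + c\<^sup>2 = real i * t\<^sup>2 + tail c i"
  proof (rule sum_min_level)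
    show "i \<le> CARD('k)"
      using i l0norm_bounds by simp
    show "t \<le> w $ e j" if "1 \<le> j" "j \<le> i" for j
      using entries_antimono[of j i] that i l0norm_bounds by simp
    show "w $ e j \<le> t" if "i < j" "j \<le> CARD('k)" for j
      using entries_antimono[of "i + 1" j] that i by simp
  qed
  also have "\<dots> = (t / \<rho>)\<^sup>2"
    unfolding tail by (simp add: algebra_simps power_divide)
  finally show "(\<Sum>j\<in>UNIV. (min (w $ j) (threshold e \<rho> w c i))\<^sup>2) + c\<^sup>2
      = (threshold e \<rho> w c i / \<rho>)\<^sup>2"
    by (simp add: t_def)
qed

text \<open>
  Only the \<open>\<ell>\<close> coordinates in the support of w can decrease. On them the sum of the
  decreases is at most \<open>\<surd>\<ell>\<close> times the distance from w, and \<open>\<rho> \<surd>\<ell> \<le> 1\<close>. The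
  certificate below is this Cauchy-Schwarz estimate.
\<close>

lemma self_optimal:
  assumes rho: "\<rho> > 0" and small: "real (l0norm w) * \<rho>\<^sup>2 \<le> 1"
  shows "is_arg_min (objective \<rho> w 0) (\<lambda>s. 0 \<le> s) w"
proof (rule optimal_if_certificate[where u = "\<chi> j. if w $ j \<noteq> 0 then \<rho> else 0" and v = 0])
  have "(norm (\<chi> j. if w $ j \<noteq> 0 then \<rho> else 0))\<^sup>2 = (\<Sum>j\<in>UNIV. if w $ j \<noteq> 0 then \<rho>\<^sup>2 else 0)"
    unfolding power2_norm_vec by (intro sum.cong) auto
  also have "\<dots> = real (l0norm w) * \<rho>\<^sup>2"
    by (simp add: l0norm_def flip: sum.inter_filter)
  finally show "(norm (\<chi> j. if w $ j \<noteq> 0 then \<rho> else 0))\<^sup>2 + 0\<^sup>2 \<le> 1"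
    using small by simp
qed (use rho nonneg in \<open>auto simp: less_eq_vec_def\<close>)

text \<open>
  With only zeros in the tail, the fixed point equation is
  \<open>t\<^sup>2 (1 - \<ell> \<rho>\<^sup>2) = \<rho>\<^sup>2 c\<^sup>2\<close>. The bound on \<open>\<rho>\<close> says that its solution does not
  exceed \<open>w\<^sub>\<ell>\<close>. In particular no entry is cut off when all entries are nonzero, so the
  formulas for full and for smaller support agree.
\<close>

lemma small_case_optimal:
  assumes rho: "\<rho> > 0" and c: "c \<ge> 0" and le: "\<rho> \<le> lower_ratio e w c"
  shows "is_arg_min (objective \<rho> w c) (\<lambda>s. 0 \<le> s) (small_case \<rho> w c)"
proof -
  define l where "l = l0norm w"
  define D where "D = 1 - real l * \<rho>\<^sup>2"
  define t where "t = \<rho> * sqrt (c\<^sup>2 / D)"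
  have wl: "w $ e l > 0" and lk: "l \<le> CARD('k)"
    using l0norm_bounds pos_up_to_l0norm by (auto simp: l_def)
  have "0 \<le> gap \<rho> c l"
    using lower_ratio_less_iff[OF rho, of c] le by (simp add: l_def)
  then have "c\<^sup>2 \<le> (w $ e l)\<^sup>2 * (1 / \<rho>\<^sup>2 - real l)"
    by (simp add: gap_def l_def tail_l0norm)
  also have "\<dots> = (w $ e l)\<^sup>2 * D / \<rho>\<^sup>2"
    using rho by (simp add: D_def field_simps)
  finally have key: "\<rho>\<^sup>2 * c\<^sup>2 \<le> (w $ e l)\<^sup>2 * D"
    using rho by (simp add: pos_le_divide_eq mult.commute)
  have "0 \<le> (w $ e l)\<^sup>2 * D"
    using key by (meson mult_nonneg_nonneg order_trans zero_le_power2)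
  then have D: "D \<ge> 0"
    using wl by (simp add: zero_le_mult_iff)
  have t_nonneg: "t \<ge> 0"
    using rho D by (simp add: t_def)
  have tl: "t \<le> w $ e l"
  proof (rule power2_le_imp_le)
    show "t\<^sup>2 \<le> (w $ e l)\<^sup>2"
    \<comment> \<open>\<open>D = 0\<close> is possible if \<open>c = 0\<close>; then \<open>t = 0\<close> by \<open>0 / 0 = 0\<close>.\<close>
    proof (cases "D = 0")
      case False
      then show ?thesis
        using D key by (simp add: t_def power_mult_distrib pos_divide_le_eq)
    qed (simp add: t_def)
  qed (use wl in simp)
  have above: "t \<le> w $ e j" if "1 \<le> j" "j \<le> l" for j
    using entries_antimono[of j l] that lk tl by simp
  have formula: "small_case \<rho> w c = pos_part (w - t *\<^sub>R 1)"
  proof (cases "l = CARD('k)")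
    case True
    have "t \<le> w $ j" for j
      using above True enumerated[of j] by metis
    then have "pos_part (w - t *\<^sub>R 1) = w - t *\<^sub>R 1"
      by (simp add: vec_eq_iff pos_part_def max_absorb1)
    then show ?thesis
      using True by (simp add: small_case_def l_def t_def D_def)
  qed (simp add: small_case_def l_def t_def D_def)
  show ?thesis
  proof (cases "c = 0")
    case True
    then have "pos_part (w - t *\<^sub>R 1) = w"
      using nonneg by (simp add: vec_eq_iff pos_part_def max_absorb1 t_def)
    then show ?thesis
      using self_optimal[OF rho] D True unfolding formula by (simp add: D_def l_def)
  next
    case False
    then have "0 < (w $ e l)\<^sup>2 * D"
      using rho by (intro less_le_trans[OF _ key]) simp
    then have "D > 0"
      using wl by (simp add: zero_less_mult_iff)
    have t: "t > 0"
      using rho False \<open>D > 0\<close> by (simp add: t_def)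
    have "t\<^sup>2 * D = \<rho>\<^sup>2 * c\<^sup>2"
      using \<open>D > 0\<close> by (simp add: t_def power_mult_distrib)
    then have "real l * t\<^sup>2 + c\<^sup>2 = (t / \<rho>)\<^sup>2"
      using rho by (simp add: D_def power_divide field_simps)
    moreover have "(\<Sum>j\<in>UNIV. (min (w $ j) t)\<^sup>2) + c\<^sup>2 = real l * t\<^sup>2 + tail c l"
      using lk above zero_beyond_l0norm t_nonneg by (intro sum_min_level) (auto simp: l_def)
    ultimately show ?thesis
      unfolding formula using rho t tail_l0norm[of c]
      by (intro optimal_if_level_fixed_point) (auto simp: l_def)
  qed
qed

end

theorem theorem6:
  fixes e :: "nat \<Rightarrow> 'k::finite" and w :: "real ^ 'k" and \<rho> c :: real
  assumes enum: "bij_betw e {1..CARD('k)} UNIV"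
    and rho: "\<rho> > 0"
    and sorted: "\<And>i. 1 \<le> i \<Longrightarrow> i < CARD('k) \<Longrightarrow> w $ e (i + 1) \<le> w $ e i"
    and nonneg: "w $ e CARD('k) \<ge> 0"
    and nonzero: "w \<noteq> 0"
    and c: "c \<ge> 0"
  shows "(lower_ratio e w c < \<rho> \<and> \<rho> < upper_ratio w c
            \<longrightarrow> (\<exists>!i. is_threshold_index e \<rho> w c i))
         \<and> is_arg_min (objective \<rho> w c) (\<lambda>s. 0 \<le> s) (d_opt e \<rho> w c)"
proof -
  interpret sorted_vector e w
    using enum sorted nonneg nonzero by unfold_locales auto
  have ex1: "\<exists>!i. is_threshold_index e \<rho> w c i"
    if "lower_ratio e w c < \<rho> \<and> \<rho> < upper_ratio w c"
    using ex1_threshold_index[OF rho] that by blast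
  have "is_arg_min (objective \<rho> w c) (\<lambda>s. 0 \<le> s) (d_opt e \<rho> w c)"
    using zero_optimal[OF rho, of c] small_case_optimal[OF rho c]
      shrunk_by_threshold_optimal[OF rho, OF theI'[OF ex1]]
    by (auto simp: d_opt_def)
  with ex1 show ?thesis
    by blast
qed

end
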